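(* Let $n, j, r$ be non-negative integers with $r\geq 2$. Then $$b'_{\leq j,r}(n)=T_{j+1,r}(n),$$ where $$b'_{\leq j,r}(n)=\sum_{\lambda\in \mathcal{D}_{\leq j,r}(n)}\bar{\ell}(\lambda)-\sum_{\lambda\in \mathcal{O}_{\leq j,r}(n)}\bar{\ell}(\lambda)$$ and $T_{j+1,r}(n)$ is the number of different parts with multiplicity between $r+1$ and $2r-1$ (inclusive) in all partitions in $\mathcal{D}_{j+1,r}(n)$.
   Context: A partition $\lambda$ of a non-negative integer $n$ is a non-increasing finite sequence of positive integers (its parts) with sum $n$; the empty partition is the only partition of $0$. $\bar{\ell}(\lambda)$ denotes the number of different parts (distinct part values) of $\lambda$. For integers $j\ge 0$, $r\ge 2$, $n \ge 0$: - $\mathcal{O}_{\leq j,r}(n)$ is the set of partitions of $n$ with at most $j$ different parts divisible by $r$. Here different means distinct part values; these parts may be repeated. - $\mathcal{D}_{j,r}(n)$ (respectively $\mathcal{D}_{\leq j,r}(n)$) is the set of partitions of $n$ in which exactly $j$ (respectively at most $j$) different parts are repeated at least $r$ times (i.e. have multiplicity at least $r$), all other parts appearing at most $r-1$ times. - $T_{j,r}(n)$ is the sum, over all $\lambda\in\mathcal{D}_{j,r}(n)$, of the number of distinct part values of $\lambda$ whose multiplicity $s$ in $\lambda$ satisfies $r+1\leq s\leq 2r-1$. Differences are taken in $\mathbb{Z}$. *)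

theory Defs
  imports "HOL-Library.Multiset"
begin

text \<open>A partition is represented by the multiset of its parts; the lemma
  \<open>bij_betw_mset_partitions\<close> below identifies this with non-increasing finite sequences of
  positive integers.\<close>

definition partitions :: "nat \<Rightarrow> nat multiset set" where
  "partitions n = {p. (\<forall>i \<in># p. 0 < i) \<and> \<Sum>\<^sub># p = n}"

definition num_different_parts :: "nat multiset \<Rightarrow> nat" where
  "num_different_parts p = card (set_mset p)"

definition O_le :: "nat \<Rightarrow> nat \<Rightarrow> nat \<Rightarrow> nat multiset set" where
  "O_le j r n = {p \<in> partitions n. card {i \<in> set_mset p. r dvd i} \<le> j}"

definition D_eq :: "nat \<Rightarrow> nat \<Rightarrow> nat \<Rightarrow> nat multiset set" where
  "D_eq j r n = {p \<in> partitions n. card {i \<in> set_mset p. r \<le> count p i} = j}"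

definition D_le :: "nat \<Rightarrow> nat \<Rightarrow> nat \<Rightarrow> nat multiset set" where
  "D_le j r n = {p \<in> partitions n. card {i \<in> set_mset p. r \<le> count p i} \<le> j}"

definition T :: "nat \<Rightarrow> nat \<Rightarrow> nat \<Rightarrow> nat" where
  "T j r n = (\<Sum>p \<in> D_eq j r n.
     card {i \<in> set_mset p. r + 1 \<le> count p i \<and> count p i \<le> 2 * r - 1})"

definition b'_le :: "nat \<Rightarrow> nat \<Rightarrow> nat \<Rightarrow> int" where
  "b'_le j r n = int (\<Sum>p \<in> D_le j r n. num_different_parts p)
     - int (\<Sum>p \<in> O_le j r n. num_different_parts p)"

lemma bij_betw_mset_partitions:
  "bij_betw mset {xs. sorted_wrt (\<ge>) xs \<and> (\<forall>x \<in> set xs. 0 < x) \<and> sum_list xs = n}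
     (partitions n)"
proof (rule bij_betw_byWitness[where f' = "\<lambda>M. rev (sorted_list_of_multiset M)"])
  show "\<forall>xs \<in> {xs. sorted_wrt (\<ge>) xs \<and> (\<forall>x \<in> set xs. 0 < x) \<and> sum_list xs = n}.
      rev (sorted_list_of_multiset (mset xs)) = xs"
  proof
    fix xs :: "nat list"
    assume "xs \<in> {xs. sorted_wrt (\<ge>) xs \<and> (\<forall>x \<in> set xs. 0 < x) \<and> sum_list xs = n}"
    then have "sorted (rev xs)" by (simp add: sorted_wrt_rev)
    then have "sort xs = rev xs" by (intro properties_for_sort) simp_all
    then show "rev (sorted_list_of_multiset (mset xs)) = xs" by simp
  qed
  show "\<forall>M \<in> partitions n. mset (rev (sorted_list_of_multiset M)) = M" by simp
  show "mset ` {xs. sorted_wrt (\<ge>) xs \<and> (\<forall>x \<in> set xs. 0 < x) \<and> sum_list xs = n}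
      \<subseteq> partitions n"
    by (auto simp: partitions_def sum_mset_sum_list)
  show "(\<lambda>M. rev (sorted_list_of_multiset M)) ` partitions n
      \<subseteq> {xs. sorted_wrt (\<ge>) xs \<and> (\<forall>x \<in> set xs. 0 < x) \<and> sum_list xs = n}"
  proof
    fix xs assume "xs \<in> (\<lambda>M. rev (sorted_list_of_multiset M)) ` partitions n"
    then obtain M where M: "M \<in> partitions n" "xs = rev (sorted_list_of_multiset M)" by auto
    have "sum_list xs = \<Sum>\<^sub># (mset xs)" by (rule sum_mset_sum_list[symmetric])
    with M show "xs \<in> {xs. sorted_wrt (\<ge>) xs \<and> (\<forall>x \<in> set xs. 0 < x) \<and> sum_list xs = n}"
      by (auto simp: partitions_def sorted_wrt_rev)
  qed
qed

text \<open>Finiteness ensures that the sums over \<^const>\<open>D_eq\<close>, \<^const>\<open>D_le\<close> and \<^const>\<open>O_le\<close>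
  are genuine.\<close>

lemma finite_partitions: "finite (partitions n)"
proof -
  have "xs \<in> {xs. set xs \<subseteq> {..n} \<and> length xs \<le> n}"
    if "\<forall>x \<in> set xs. 0 < x" "sum_list xs = n" for xs :: "nat list"
  proof -
    have "length xs \<le> sum_list xs" using that(1) by (induction xs) auto
    then show ?thesis using that(2) member_le_sum_list by fastforce
  qed
  then have "{xs. sorted_wrt (\<ge>) xs \<and> (\<forall>x \<in> set xs. 0 < x) \<and> sum_list xs = n}
      \<subseteq> {xs. set xs \<subseteq> {..n} \<and> length xs \<le> n}"
    by blast
  then have "finite {xs. sorted_wrt (\<ge>) xs \<and> (\<forall>x \<in> set xs. 0 < x) \<and> sum_list xs = n}"
    using finite_lists_length_le[of "{..n}" n] finite_subset by blast
  then show ?thesis using bij_betw_mset_partitions bij_betw_finite by blast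
qed

end

theory Submission
  imports Defs
begin

text \<open>
  Write \<open>d \<lambda>\<close> for the number of part values of \<open>\<lambda>\<close> of multiplicity at least \<open>r\<close>, \<open>e \<lambda>\<close> for the
  number of part values divisible by \<open>r\<close>, \<open>\<ell> \<lambda>\<close> for the number of all part values, and \<open>t \<lambda>\<close> for
  the number of those with multiplicity strictly between \<open>r\<close> and \<open>2 r\<close>. The theorem is the case
  \<open>f m = of_bool (m \<le> j)\<close> of an identity that holds for every function \<open>f\<close>, all sums being over
  the partitions \<open>\<lambda>\<close> of \<open>n\<close>:
  \<open>(\<Sum>\<lambda>. \<ell> \<lambda> * f (e \<lambda>)) = (\<Sum>\<lambda>. \<ell> \<lambda> * f (d \<lambda>)) + (\<Sum>\<lambda>. t \<lambda> * (f (d \<lambda>) - f (d \<lambda> - 1)))\<close>;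
  indeed, for this \<open>f\<close> the difference \<open>f (d \<lambda>) - f (d \<lambda> - 1)\<close> is \<open>-1\<close> if \<open>d \<lambda> = j + 1\<close> and \<open>0\<close>
  otherwise. The identity is linear in \<open>f\<close>, and on a finite range every \<open>f\<close> is a combination of the
  functions \<open>m \<mapsto> m choose k\<close> (\<open>binomial_basis\<close>), so that it suffices to treat these.

  For \<open>f m = m choose k\<close> the sums count partitions with \<open>k\<close> marks on distinct part values that are
  divisible by \<open>r\<close> (in the sum with \<open>e\<close>) or repeated at least \<open>r\<close> times (in the sums with \<open>d\<close>),
  weighted by \<open>\<ell>\<close>, or in the last sum by the number of marked part values that \<open>t\<close> counts.
  Removing \<open>r\<close> copies of each marked repeated part \<open>s\<close>, or one copy of each marked multiple
  \<open>r * s\<close>, leads in both cases to the same objects: a set \<open>S\<close> of \<open>k\<close> positive integers together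
  with an arbitrary partition \<open>\<mu>\<close>, where \<open>r * \<Sum>S\<close> and the sum of \<open>\<mu>\<close> add up to \<open>n\<close>.
  In these terms, the number of part values of \<open>\<lambda>\<close> is \<open>card (\<mu> \<union> S)\<close> in the first case and
  \<open>card (\<mu> \<union> r S)\<close> in the second, while the sum with \<open>t\<close> counts the
  \<open>s \<in> S\<close> that occur in \<open>\<mu>\<close> fewer than \<open>r\<close> times, but at least once.
  What remains to be seen is that, in total, as many \<open>s \<in> S\<close> occur at least \<open>r\<close> times in \<open>\<mu>\<close> as
  have \<open>r * s\<close> in \<open>\<mu>\<close>; and merging \<open>r\<close> copies of \<open>s\<close> in \<open>\<mu>\<close> into one part \<open>r * s\<close> is a
  bijection that proves this (\<open>sum_repeated_marks_eq_sum_multiple_marks\<close>).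
\<close>

section \<open>Counting with binomial coefficients\<close>

text \<open>Newton interpolation at \<open>0, \<dots>, N\<close>.\<close>

lemma binomial_basis:
  fixes f :: "nat \<Rightarrow> int"
  shows "\<exists>c. \<forall>d\<le>N. f d = (\<Sum>k\<le>N. c k * int (d choose k))"
proof (induction N)
  case 0
  show ?case by (rule exI[of _ f]) simp
next
  case (Suc N)
  then obtain c where c: "\<And>d. d \<le> N \<Longrightarrow> f d = (\<Sum>k\<le>N. c k * int (d choose k))"
    by blast
  define c' where "c' = c(Suc N := f (Suc N) - (\<Sum>k\<le>N. c k * int (Suc N choose k)))"
  have below: "(\<Sum>k\<le>N. c' k * int (d choose k)) = (\<Sum>k\<le>N. c k * int (d choose k))" for d
    by (rule sum.cong) (auto simp: c'_def)
  have "f d = (\<Sum>k\<le>Suc N. c' k * int (d choose k))" if "d \<le> Suc N" for d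
  proof (cases "d = Suc N")
    case True
    then show ?thesis using below[of d] by (simp add: c'_def)
  next
    case False
    with that have "d \<le> N" by simp
    then show ?thesis using below[of d] c[of d] by simp
  qed
  then show ?case by blast
qed

lemma sum_mult_choose:
  assumes "finite P" "\<And>x. x \<in> P \<Longrightarrow> finite (A x)"
  shows "(\<Sum>x\<in>P. g x * (card (A x) choose k))
    = (\<Sum>(x, S)\<in>(SIGMA x:P. {S. S \<subseteq> A x \<and> card S = k}). g x)"
proof -
  have "(\<Sum>(x, S)\<in>(SIGMA x:P. {S. S \<subseteq> A x \<and> card S = k}). g x)
    = (\<Sum>x\<in>P. \<Sum>S\<in>{S. S \<subseteq> A x \<and> card S = k}. g x)"
    using assms by (intro sum.Sigma[symmetric]) auto
  also have "\<dots> = (\<Sum>x\<in>P. g x * (card (A x) choose k))"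
    by (rule sum.cong) (auto simp: assms(2) n_subsets mult.commute)
  finally show ?thesis by simp
qed

text \<open>Counting the pairs of a \<open>k\<close>-subset \<open>S\<close> and an element of \<open>S \<inter> B\<close> in the other order: the
  \<open>k\<close>-subsets of \<open>A\<close> that contain a given point are all but those that avoid it.\<close>

lemma sum_card_Int_subsets:
  assumes "finite A" "B \<subseteq> A"
  shows "int (\<Sum>S\<in>{S. S \<subseteq> A \<and> card S = k}. card (S \<inter> B))
    = int (card B) * (int (card A choose k) - int ((card A - 1) choose k))"
proof -
  let ?K = "{S. S \<subseteq> A \<and> card S = k}"
  have finB: "finite B" using assms finite_subset by blast
  have finK: "finite ?K" using assms(1) by simp
  have through: "int (card {S \<in> ?K. x \<in> S})
      = int (card A choose k) - int ((card A - 1) choose k)" if "x \<in> B" for x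
  proof -
    have "card {S \<in> ?K. x \<in> S} + card {S. S \<subseteq> A - {x} \<and> card S = k}
      = card ({S \<in> ?K. x \<in> S} \<union> {S. S \<subseteq> A - {x} \<and> card S = k})"
      using assms(1) by (intro card_Un_disjoint[symmetric]) auto
    also have "{S \<in> ?K. x \<in> S} \<union> {S. S \<subseteq> A - {x} \<and> card S = k} = ?K" by auto
    also have "card ?K = (card A choose k)" using assms(1) by (rule n_subsets)
    also have "card {S. S \<subseteq> A - {x} \<and> card S = k} = ((card A - 1) choose k)"
      using assms that by (subst n_subsets) auto
    finally show ?thesis by linarith
  qed
  have "(\<Sum>S\<in>?K. card (S \<inter> B)) = (\<Sum>S\<in>?K. card {x \<in> B. x \<in> S})"
    by (rule sum.cong) (auto intro: arg_cong[where f = card])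
  also have "\<dots> = (\<Sum>x\<in>B. card {S \<in> ?K. x \<in> S})"
    using sum.swap_restrict[OF finK finB, of "\<lambda>_ _. 1 :: nat" "\<lambda>S x. x \<in> S"] by simp
  finally show ?thesis using through by (simp add: of_nat_sum)
qed

section \<open>Partitions with marked special parts\<close>

definition repeated_parts :: "nat \<Rightarrow> nat multiset \<Rightarrow> nat set" where
  "repeated_parts r p = {i \<in> set_mset p. r \<le> count p i}"

definition multiple_parts :: "nat \<Rightarrow> nat multiset \<Rightarrow> nat set" where
  "multiple_parts r p = {i \<in> set_mset p. r dvd i}"

definition middle_parts :: "nat \<Rightarrow> nat multiset \<Rightarrow> nat set" where
  "middle_parts r p = {i \<in> set_mset p. r + 1 \<le> count p i \<and> count p i \<le> 2 * r - 1}"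

text \<open>The common form of partitions with \<open>k\<close> marked repeated parts and of partitions with \<open>k\<close>
  marked parts divisible by \<open>r\<close>: the marks, each of which stands for a weight of \<open>r\<close> times its
  value, and the partition that is left.\<close>

definition split_pairs :: "nat \<Rightarrow> nat \<Rightarrow> nat \<Rightarrow> (nat set \<times> nat multiset) set" where
  "split_pairs r k n = {(S, \<mu>). finite S \<and> card S = k \<and> 0 \<notin> S \<and> 0 \<notin># \<mu>
     \<and> r * \<Sum>S + \<Sum>\<^sub># \<mu> = n}"

lemma sum_mset_mset_set: "\<Sum>\<^sub># (mset_set S) = \<Sum>S"
  by (simp add: sum_unfold_sum_mset)

lemma sum_mset_repeat_mset_nat: "\<Sum>\<^sub># (repeat_mset r M) = r * \<Sum>\<^sub># (M :: nat multiset)"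
  by (induction r) (auto simp: algebra_simps)

lemma set_mset_repeat_mset_set:
  assumes "r \<ge> 1" "finite S"
  shows "set_mset (repeat_mset r (mset_set S)) = S"
  using assms by (auto simp: set_mset_def count_mset_set')

lemma finite_repeated_parts [simp]: "finite (repeated_parts r p)"
  by (simp add: repeated_parts_def)

lemma finite_multiple_parts [simp]: "finite (multiple_parts r p)"
  by (simp add: multiple_parts_def)

lemma repeated_marks_bij:
  assumes "r \<ge> 1"
  shows "bij_betw (\<lambda>(S, \<mu>). (\<mu> + repeat_mset r (mset_set S), S)) (split_pairs r k n)
    (SIGMA p:partitions n. {S. S \<subseteq> repeated_parts r p \<and> card S = k})"
proof (rule bij_betw_byWitness[where f' = "\<lambda>(p, S). (S, p - repeat_mset r (mset_set S))"])
  let ?X = "split_pairs r k n"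
  let ?Y = "SIGMA p:partitions n. {S. S \<subseteq> repeated_parts r p \<and> card S = k}"
  have marks: "repeat_mset r (mset_set S) \<subseteq># p" "finite S" if "S \<subseteq> repeated_parts r p" for S p
  proof -
    show fin: "finite S" using that finite_subset finite_repeated_parts by blast
    show "repeat_mset r (mset_set S) \<subseteq># p"
      using that fin by (auto simp: subseteq_mset_def repeated_parts_def count_mset_set')
  qed
  show "\<forall>x\<in>?X. (case (case x of (S, \<mu>) \<Rightarrow> (\<mu> + repeat_mset r (mset_set S), S)) of
      (p, S) \<Rightarrow> (S, p - repeat_mset r (mset_set S))) = x"
    by auto
  show "\<forall>y\<in>?Y. (case (case y of (p, S) \<Rightarrow> (S, p - repeat_mset r (mset_set S))) of
      (S, \<mu>) \<Rightarrow> (\<mu> + repeat_mset r (mset_set S), S)) = y"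
    using marks by auto
  show "(\<lambda>(S, \<mu>). (\<mu> + repeat_mset r (mset_set S), S)) ` ?X \<subseteq> ?Y"
  proof (rule image_subsetI)
    fix x assume "x \<in> ?X"
    then obtain S \<mu> where x: "x = (S, \<mu>)" "finite S" "card S = k" "0 \<notin> S" "0 \<notin># \<mu>"
      "r * \<Sum>S + \<Sum>\<^sub># \<mu> = n" by (auto simp: split_pairs_def)
    have "0 \<notin># \<mu> + repeat_mset r (mset_set S)" using x by (simp add: not_in_iff)
    then have "\<forall>i\<in>#\<mu> + repeat_mset r (mset_set S). 0 < i" by (metis gr0I)
    then have "\<mu> + repeat_mset r (mset_set S) \<in> partitions n"
      using x(6) by (simp add: partitions_def sum_mset_repeat_mset_nat sum_mset_mset_set)
    moreover have "S \<subseteq> repeated_parts r (\<mu> + repeat_mset r (mset_set S))"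
      using x assms by (auto simp: repeated_parts_def set_mset_repeat_mset_set)
    ultimately show "(\<lambda>(S, \<mu>). (\<mu> + repeat_mset r (mset_set S), S)) x \<in> ?Y"
      using x by simp
  qed
  show "(\<lambda>(p, S). (S, p - repeat_mset r (mset_set S))) ` ?Y \<subseteq> ?X"
  proof (rule image_subsetI)
    fix y assume "y \<in> ?Y"
    then obtain p S where y: "y = (p, S)" "p \<in> partitions n" "S \<subseteq> repeated_parts r p" "card S = k"
      by auto
    have "\<Sum>\<^sub># (p - repeat_mset r (mset_set S)) + \<Sum>\<^sub># (repeat_mset r (mset_set S)) = \<Sum>\<^sub># p"
      using marks[OF y(3)] by (metis subset_mset.diff_add sum_mset.union)
    then have "r * \<Sum>S + \<Sum>\<^sub># (p - repeat_mset r (mset_set S)) = n"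
      using y(2) by (simp add: partitions_def sum_mset_repeat_mset_nat sum_mset_mset_set)
    moreover have "0 \<notin> S" "0 \<notin># p - repeat_mset r (mset_set S)"
      using y(2,3) by (auto simp: partitions_def repeated_parts_def dest: in_diffD)
    ultimately show "(\<lambda>(p, S). (S, p - repeat_mset r (mset_set S))) y \<in> ?X"
      using y marks[OF y(3)] by (simp add: split_pairs_def)
  qed
qed

lemma multiple_marks_bij:
  assumes "r \<ge> 1"
  shows "bij_betw (\<lambda>(S, \<mu>). (\<mu> + mset_set ((*) r ` S), (*) r ` S)) (split_pairs r k n)
    (SIGMA p:partitions n. {S. S \<subseteq> multiple_parts r p \<and> card S = k})"
proof (rule bij_betw_byWitness[where f' = "\<lambda>(p, S). ((\<lambda>i. i div r) ` S, p - mset_set S)"])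
  let ?X = "split_pairs r k n"
  let ?Y = "SIGMA p:partitions n. {S. S \<subseteq> multiple_parts r p \<and> card S = k}"
  have inj: "inj_on ((*) r) S" for S using assms by (auto simp: inj_on_def)
  have div_mult: "(\<lambda>i. i div r) ` (*) r ` S = S" for S using assms by (simp add: image_image)
  have marks: "mset_set S \<subseteq># p" "finite S" "(*) r ` (\<lambda>i. i div r) ` S = S"
    if "S \<subseteq> multiple_parts r p" for S p
  proof -
    show fin: "finite S" using that finite_subset finite_multiple_parts by blast
    show "mset_set S \<subseteq># p"
      using that fin by (auto simp: subseteq_mset_def multiple_parts_def count_mset_set')
    have "(\<lambda>i. r * (i div r)) ` S = (\<lambda>i. i) ` S"
      using that by (intro image_cong) (auto simp: multiple_parts_def)
    then show "(*) r ` (\<lambda>i. i div r) ` S = S" by (simp add: image_image)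
  qed
  show "\<forall>x\<in>?X. (case (case x of (S, \<mu>) \<Rightarrow> (\<mu> + mset_set ((*) r ` S), (*) r ` S)) of
      (p, S) \<Rightarrow> ((\<lambda>i. i div r) ` S, p - mset_set S)) = x"
    by (simp only: div_mult case_prod_beta fst_conv snd_conv add_diff_cancel_right' prod.collapse)
      simp
  show "\<forall>y\<in>?Y. (case (case y of (p, S) \<Rightarrow> ((\<lambda>i. i div r) ` S, p - mset_set S)) of
      (S, \<mu>) \<Rightarrow> (\<mu> + mset_set ((*) r ` S), (*) r ` S)) = y"
  proof
    fix y assume "y \<in> ?Y"
    then obtain p S where y: "y = (p, S)" "S \<subseteq> multiple_parts r p" by auto
    show "(case (case y of (p, S) \<Rightarrow> ((\<lambda>i. i div r) ` S, p - mset_set S)) of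
      (S, \<mu>) \<Rightarrow> (\<mu> + mset_set ((*) r ` S), (*) r ` S)) = y"
      unfolding y(1) prod.case marks(3)[OF y(2)] using marks(1)[OF y(2)] by simp
  qed
  show "(\<lambda>(S, \<mu>). (\<mu> + mset_set ((*) r ` S), (*) r ` S)) ` ?X \<subseteq> ?Y"
  proof (rule image_subsetI)
    fix x assume "x \<in> ?X"
    then obtain S \<mu> where x: "x = (S, \<mu>)" "finite S" "card S = k" "0 \<notin> S" "0 \<notin># \<mu>"
      "r * \<Sum>S + \<Sum>\<^sub># \<mu> = n" by (auto simp: split_pairs_def)
    have "\<Sum>((*) r ` S) = r * \<Sum>S"
      by (simp add: sum.reindex[OF inj] sum_distrib_left)
    then have "\<mu> + mset_set ((*) r ` S) \<in> partitions n"
      using x assms by (auto simp: partitions_def sum_mset_mset_set intro: gr0I)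
    moreover have "(*) r ` S \<subseteq> multiple_parts r (\<mu> + mset_set ((*) r ` S))"
      using x by (auto simp: multiple_parts_def)
    ultimately show "(\<lambda>(S, \<mu>). (\<mu> + mset_set ((*) r ` S), (*) r ` S)) x \<in> ?Y"
      using x by (simp add: card_image[OF inj])
  qed
  show "(\<lambda>(p, S). ((\<lambda>i. i div r) ` S, p - mset_set S)) ` ?Y \<subseteq> ?X"
  proof (rule image_subsetI)
    fix y assume "y \<in> ?Y"
    then obtain p S where y: "y = (p, S)" "p \<in> partitions n" "S \<subseteq> multiple_parts r p" "card S = k"
      by auto
    define S' where "S' = (\<lambda>i. i div r) ` S"
    have S: "S = (*) r ` S'" using marks(3)[OF y(3)] by (simp add: S'_def)
    have "\<Sum>\<^sub># (p - mset_set S) + \<Sum>S = \<Sum>\<^sub># p"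
      using marks(1)[OF y(3)] by (metis subset_mset.diff_add sum_mset.union sum_mset_mset_set)
    moreover have "\<Sum>S = r * \<Sum>S'"
      by (simp add: S sum.reindex[OF inj] sum_distrib_left)
    ultimately have "r * \<Sum>S' + \<Sum>\<^sub># (p - mset_set S) = n"
      using y(2) by (simp add: partitions_def)
    moreover have "0 \<notin> S" "0 \<notin># p - mset_set S"
      using y(2,3) by (auto simp: partitions_def multiple_parts_def dest: in_diffD)
    moreover have "0 \<notin> S'" using \<open>0 \<notin> S\<close> by (auto simp: S)
    moreover have "card S' = k" using y(4) by (simp add: S card_image[OF inj])
    moreover have "finite S'" using marks(2)[OF y(3)] by (simp add: S'_def)
    ultimately show "(\<lambda>(p, S). ((\<lambda>i. i div r) ` S, p - mset_set S)) y \<in> ?X"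
      by (simp add: split_pairs_def y(1) S'_def[symmetric])
  qed
qed

lemma finite_split_pairs:
  assumes "r \<ge> 1"
  shows "finite (split_pairs r k n)"
  using bij_betw_finite[OF repeated_marks_bij[OF assms]] finite_partitions by simp

section \<open>The moments in terms of marks and remainder\<close>

lemma card_Un_plus_card_filter:
  assumes "finite S" "finite M" "inj_on h S"
  shows "card (M \<union> h ` S) + card {s \<in> S. h s \<in> M} = card M + card S"
proof -
  have "h ` {s \<in> S. h s \<in> M} = M \<inter> h ` S" by auto
  moreover have "card (h ` {s \<in> S. h s \<in> M}) = card {s \<in> S. h s \<in> M}"
    using assms(3) by (intro card_image) (auto simp: inj_on_def)
  ultimately show ?thesis
    using card_Un_Int[of M "h ` S"] assms by (simp add: card_image)
qed

text \<open>In terms of a split pair the weight is the size of a union. Written by inclusion and exclusion,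
  it differs between this lemma and the next only in the number of marked values (here \<open>s\<close>, there
  \<open>r * s\<close>) that are also parts of \<open>\<mu>\<close>.\<close>

lemma repeated_moment:
  assumes "r \<ge> 1"
  shows "(\<Sum>p\<in>partitions n. num_different_parts p * (card (repeated_parts r p) choose k))
      + (\<Sum>(S, \<mu>)\<in>split_pairs r k n. card {s \<in> S. s \<in># \<mu>})
    = (\<Sum>(S, \<mu>)\<in>split_pairs r k n. card (set_mset \<mu>) + card S)"
proof -
  have "(\<Sum>p\<in>partitions n. num_different_parts p * (card (repeated_parts r p) choose k))
    = (\<Sum>(S, \<mu>)\<in>split_pairs r k n. card (set_mset \<mu> \<union> S))"
    unfolding sum_mult_choose[OF finite_partitions finite_repeated_parts]
    by (subst sum.reindex_bij_betw[OF repeated_marks_bij[OF assms], symmetric])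
      (use assms in \<open>auto simp: num_different_parts_def split_pairs_def set_mset_repeat_mset_set
        intro!: sum.cong\<close>)
  then show ?thesis
    using card_Un_plus_card_filter[where h = id]
    by (auto simp: sum.distrib[symmetric] split_pairs_def intro!: sum.cong)
qed

lemma multiple_moment:
  assumes "r \<ge> 1"
  shows "(\<Sum>p\<in>partitions n. num_different_parts p * (card (multiple_parts r p) choose k))
      + (\<Sum>(S, \<mu>)\<in>split_pairs r k n. card {s \<in> S. r * s \<in># \<mu>})
    = (\<Sum>(S, \<mu>)\<in>split_pairs r k n. card (set_mset \<mu>) + card S)"
proof -
  have "(\<Sum>p\<in>partitions n. num_different_parts p * (card (multiple_parts r p) choose k))
    = (\<Sum>(S, \<mu>)\<in>split_pairs r k n. card (set_mset \<mu> \<union> (*) r ` S))"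
    unfolding sum_mult_choose[OF finite_partitions finite_multiple_parts]
    by (subst sum.reindex_bij_betw[OF multiple_marks_bij[OF assms], symmetric])
      (use assms in \<open>auto simp: num_different_parts_def split_pairs_def intro!: sum.cong\<close>)
  moreover have "inj_on ((*) r) S" for S using assms by (auto simp: inj_on_def)
  ultimately show ?thesis
    using card_Un_plus_card_filter[where h = "(*) r"]
    by (auto simp: sum.distrib[symmetric] split_pairs_def intro!: sum.cong)
qed

text \<open>The difference of binomial coefficients counts the markings for which a given middle part
  is itself marked; removing \<open>r\<close> copies of it leaves between \<open>1\<close> and \<open>r - 1\<close>.\<close>

lemma middle_moment:
  assumes "r \<ge> 1"
  shows "(\<Sum>p\<in>partitions n. int (card (middle_parts r p))
        * (int (card (repeated_parts r p) choose k) - int ((card (repeated_parts r p) - 1) choose k)))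
    = int (\<Sum>(S, \<mu>)\<in>split_pairs r k n. card {s \<in> S. s \<in># \<mu> \<and> count \<mu> s < r})"
proof -
  let ?Y = "SIGMA p:partitions n. {S. S \<subseteq> repeated_parts r p \<and> card S = k}"
  have "(\<Sum>p\<in>partitions n. int (card (middle_parts r p))
        * (int (card (repeated_parts r p) choose k) - int ((card (repeated_parts r p) - 1) choose k)))
    = (\<Sum>p\<in>partitions n. int (\<Sum>S\<in>{S. S \<subseteq> repeated_parts r p \<and> card S = k}.
        card (S \<inter> middle_parts r p)))"
    by (intro sum.cong refl sum_card_Int_subsets[symmetric])
      (auto simp: middle_parts_def repeated_parts_def)
  also have "\<dots> = int (\<Sum>(p, S)\<in>?Y. card (S \<inter> middle_parts r p))"
    by (simp add: sum.Sigma finite_partitions flip: of_nat_sum)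
  also have "(\<Sum>(p, S)\<in>?Y. card (S \<inter> middle_parts r p))
    = (\<Sum>(S, \<mu>)\<in>split_pairs r k n. card (S \<inter> middle_parts r (\<mu> + repeat_mset r (mset_set S))))"
    by (subst sum.reindex_bij_betw[OF repeated_marks_bij[OF assms], symmetric])
      (auto intro!: sum.cong)
  also have "\<dots> = (\<Sum>(S, \<mu>)\<in>split_pairs r k n. card {s \<in> S. s \<in># \<mu> \<and> count \<mu> s < r})"
  proof (intro sum.cong refl, clarify)
    fix S \<mu> assume "(S, \<mu>) \<in> split_pairs r k n"
    then have "finite S" by (simp add: split_pairs_def)
    then have "S \<inter> middle_parts r (\<mu> + repeat_mset r (mset_set S))
        = {s \<in> S. s \<in># \<mu> \<and> count \<mu> s < r}"
      using assms by (auto simp: middle_parts_def count_mset_set' simp flip: count_greater_zero_iff)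
    then show "card (S \<inter> middle_parts r (\<mu> + repeat_mset r (mset_set S)))
        = card {s \<in> S. s \<in># \<mu> \<and> count \<mu> s < r}" by simp
  qed
  finally show ?thesis .
qed

text \<open>Merging \<open>r\<close> copies of a marked value \<open>s\<close> into the part \<open>r * s\<close> is invertible as long as \<open>s\<close>
  is remembered.\<close>

lemma sum_repeated_marks_eq_sum_multiple_marks:
  assumes "r \<ge> 1"
  shows "(\<Sum>(S, \<mu>)\<in>split_pairs r k n. card {s \<in> S. r \<le> count \<mu> s})
    = (\<Sum>(S, \<mu>)\<in>split_pairs r k n. card {s \<in> S. r * s \<in># \<mu>})"
proof -
  let ?X = "split_pairs r k n"
  let ?A = "SIGMA x:?X. {s \<in> fst x. r \<le> count (snd x) s}"
  let ?B = "SIGMA x:?X. {s \<in> fst x. r * s \<in># snd x}"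
  have fin: "finite (fst x)" if "x \<in> ?X" for x using that by (auto simp: split_pairs_def)
  have "bij_betw (\<lambda>((S, \<mu>), s). ((S, \<mu> - replicate_mset r s + {#r * s#}), s)) ?A ?B"
  proof (rule bij_betw_byWitness[where
        f' = "\<lambda>((S, \<mu>), s). ((S, \<mu> - {#r * s#} + replicate_mset r s), s)"])
    let ?f = "\<lambda>((S, \<mu>), s). ((S, \<mu> - replicate_mset r s + {#r * s#}), s)"
    let ?g = "\<lambda>((S, \<mu>), s). ((S, \<mu> - {#r * s#} + replicate_mset r s), s)"
    show "\<forall>a\<in>?A. ?g (?f a) = a"
      by (auto simp: count_le_replicate_mset_subset_eq)
    show "\<forall>b\<in>?B. ?f (?g b) = b" by auto
    show "?f ` ?A \<subseteq> ?B"
    proof (rule image_subsetI)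
      fix a assume "a \<in> ?A"
      then obtain S \<mu> s where a: "a = ((S, \<mu>), s)" "(S, \<mu>) \<in> ?X" "s \<in> S" "r \<le> count \<mu> s"
        by auto
      have "replicate_mset r s \<subseteq># \<mu>" using a(4) by (simp add: count_le_replicate_mset_subset_eq)
      then obtain \<nu> where \<nu>: "\<mu> = replicate_mset r s + \<nu>"
        by (auto simp: mset_subset_eq_exists_conv)
      have "0 \<notin> S" using a(2) by (simp add: split_pairs_def)
      then have "s \<noteq> 0" using a(3) by metis
      then have "(S, add_mset (r * s) \<nu>) \<in> ?X"
        using a(2) assms unfolding \<nu> split_pairs_def by simp
      then show "?f a \<in> ?B" using a(3) unfolding a(1) \<nu> by simp
    qed
    show "?g ` ?B \<subseteq> ?A"
    proof (rule image_subsetI)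
      fix b assume "b \<in> ?B"
      then obtain S \<mu> s where b: "b = ((S, \<mu>), s)" "(S, \<mu>) \<in> ?X" "s \<in> S" "r * s \<in># \<mu>"
        by auto
      then obtain \<nu> where \<nu>: "\<mu> = add_mset (r * s) \<nu>" by (blast dest: multi_member_split)
      have "0 \<notin> S" using b(2) by (simp add: split_pairs_def)
      then have "s \<noteq> 0" using b(3) by metis
      then have "(S, \<nu> + replicate_mset r s) \<in> ?X"
        using b(2) assms unfolding \<nu> split_pairs_def by (simp add: not_in_iff)
      then show "?g b \<in> ?A" using b(3) unfolding b(1) \<nu> by simp
    qed
  qed
  then have "card ?A = card ?B" by (rule bij_betw_same_card)
  then show ?thesis
    using fin finite_split_pairs[OF assms] by (simp add: case_prod_beta)
qed

text \<open>Comparing the two moments leaves the number of marks \<open>s\<close> occurring in \<open>\<mu>\<close>, less the number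
  of those with \<open>r * s\<close> in \<open>\<mu>\<close>. By the merging bijection the latter cancel the \<open>s\<close> of multiplicity
  at least \<open>r\<close>, and what survives is the moment of the middle parts.\<close>

lemma binomial_moment_identity:
  fixes r k n :: nat
  assumes "r \<ge> 1"
  defines "d \<equiv> \<lambda>p. card (repeated_parts r p)"
  shows "(\<Sum>p\<in>partitions n. int (num_different_parts p) * int (card (multiple_parts r p) choose k))
    = (\<Sum>p\<in>partitions n. int (num_different_parts p) * int (d p choose k))
      + (\<Sum>p\<in>partitions n. int (card (middle_parts r p))
          * (int (d p choose k) - int ((d p - 1) choose k)))"
proof -
  have "card {s \<in> S. s \<in># \<mu>}
      = card {s \<in> S. s \<in># \<mu> \<and> count \<mu> s < r} + card {s \<in> S. r \<le> count \<mu> s}"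
    if "(S, \<mu>) \<in> split_pairs r k n" for S \<mu>
  proof -
    have "finite S" using that by (simp add: split_pairs_def)
    moreover have "{s \<in> S. s \<in># \<mu>}
        = {s \<in> S. s \<in># \<mu> \<and> count \<mu> s < r} \<union> {s \<in> S. r \<le> count \<mu> s}"
      using assms(1) by (auto simp flip: count_greater_zero_iff)
    ultimately show ?thesis by (simp add: card_Un_disjoint disjoint_iff)
  qed
  then have "(\<Sum>(S, \<mu>)\<in>split_pairs r k n. card {s \<in> S. s \<in># \<mu>})
    = (\<Sum>(S, \<mu>)\<in>split_pairs r k n. card {s \<in> S. s \<in># \<mu> \<and> count \<mu> s < r})
      + (\<Sum>(S, \<mu>)\<in>split_pairs r k n. card {s \<in> S. r \<le> count \<mu> s})"
    by (auto simp: sum.distrib[symmetric] intro!: sum.cong)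
  moreover note sum_repeated_marks_eq_sum_multiple_marks[OF assms(1), of k n]
    repeated_moment[OF assms(1), of k n] multiple_moment[OF assms(1), of k n]
  ultimately have "(\<Sum>p\<in>partitions n. num_different_parts p * (card (multiple_parts r p) choose k))
    = (\<Sum>p\<in>partitions n. num_different_parts p * (d p choose k))
      + (\<Sum>(S, \<mu>)\<in>split_pairs r k n. card {s \<in> S. s \<in># \<mu> \<and> count \<mu> s < r})"
    unfolding d_def by linarith
  then have "int (\<Sum>p\<in>partitions n. num_different_parts p * (card (multiple_parts r p) choose k))
    = int (\<Sum>p\<in>partitions n. num_different_parts p * (d p choose k))
      + int (\<Sum>(S, \<mu>)\<in>split_pairs r k n. card {s \<in> S. s \<in># \<mu> \<and> count \<mu> s < r})"
    by linarith
  then show ?thesis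
    unfolding d_def middle_moment[OF assms(1)] by simp
qed

section \<open>From binomial coefficients to arbitrary weights\<close>

text \<open>The truncated \<open>d p - 1\<close> is harmless: a partition with a middle part has a repeated part, so
  that the terms with \<open>d p = 0\<close> vanish.\<close>

theorem weighted_identity:
  fixes f :: "nat \<Rightarrow> int" and r n :: nat
  assumes "r \<ge> 1"
  defines "d \<equiv> \<lambda>p. card (repeated_parts r p)"
  shows "(\<Sum>p\<in>partitions n. int (num_different_parts p) * f (card (multiple_parts r p)))
    = (\<Sum>p\<in>partitions n. int (num_different_parts p) * f (d p))
      + (\<Sum>p\<in>partitions n. int (card (middle_parts r p)) * (f (d p) - f (d p - 1)))"
proof -
  let ?P = "partitions n"
  define N where "N = (\<Sum>p\<in>?P. card (set_mset p))"
  obtain c where c: "\<And>m. m \<le> N \<Longrightarrow> f m = (\<Sum>k\<le>N. c k * int (m choose k))"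
    using binomial_basis by metis
  have N: "card (set_mset p) \<le> N" if "p \<in> ?P" for p
    unfolding N_def using that by (intro member_le_sum finite_partitions) auto
  have d: "d p \<le> N" if "p \<in> ?P" for p
    using N[OF that] unfolding d_def repeated_parts_def
    by (rule order.trans[rotated]) (auto intro: card_mono)
  have e: "card (multiple_parts r p) \<le> N" if "p \<in> ?P" for p
    using N[OF that] unfolding multiple_parts_def
    by (rule order.trans[rotated]) (auto intro: card_mono)
  \<comment> \<open>Each of the three sums, for \<open>f\<close>, is the \<open>c\<close>-combination of its binomial instances.\<close>
  have expand: "(\<Sum>p\<in>?P. w p * (\<Sum>k\<le>N. c k * b p k)) = (\<Sum>k\<le>N. c k * (\<Sum>p\<in>?P. w p * b p k))"
    for w :: "nat multiset \<Rightarrow> int" and b :: "nat multiset \<Rightarrow> nat \<Rightarrow> int"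
    unfolding sum_distrib_left mult.left_commute[of "c _"] by (rule sum.swap)
  have "(\<Sum>p\<in>?P. int (num_different_parts p) * f (card (multiple_parts r p)))
    = (\<Sum>k\<le>N. c k * (\<Sum>p\<in>?P. int (num_different_parts p)
        * int (card (multiple_parts r p) choose k)))"
    unfolding expand[symmetric] by (rule sum.cong) (simp_all add: c[OF e])
  moreover have "(\<Sum>p\<in>?P. int (num_different_parts p) * f (d p))
    = (\<Sum>k\<le>N. c k * (\<Sum>p\<in>?P. int (num_different_parts p) * int (d p choose k)))"
    unfolding expand[symmetric] by (rule sum.cong) (simp_all add: c[OF d])
  moreover have "(\<Sum>p\<in>?P. int (card (middle_parts r p)) * (f (d p) - f (d p - 1)))
    = (\<Sum>k\<le>N. c k * (\<Sum>p\<in>?P. int (card (middle_parts r p))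
        * (int (d p choose k) - int ((d p - 1) choose k))))"
    unfolding expand[symmetric]
  proof (rule sum.cong)
    fix p assume "p \<in> ?P"
    then have "d p \<le> N" "d p - 1 \<le> N" using d[of p] by simp_all
    then show "int (card (middle_parts r p)) * (f (d p) - f (d p - 1))
      = int (card (middle_parts r p))
        * (\<Sum>k\<le>N. c k * (int (d p choose k) - int ((d p - 1) choose k)))"
      by (simp add: c right_diff_distrib sum_subtractf)
  qed simp
  ultimately show ?thesis
    unfolding d_def binomial_moment_identity[OF assms(1)]
    by (simp only: distrib_left sum.distrib)
qed

theorem theorem5:
  fixes n j r :: nat
  assumes "r \<ge> 2"
  shows "b'_le j r n = int (T (j + 1) r n)"
proof -
  let ?P = "partitions n"
  let ?d = "\<lambda>p. card (repeated_parts r p)"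
  define f :: "nat \<Rightarrow> int" where "f = (\<lambda>m. of_bool (m \<le> j))"
  have restrict: "(\<Sum>p\<in>{p \<in> ?P. Q p}. int (g p)) = (\<Sum>p\<in>?P. int (g p) * of_bool (Q p))" for g Q
    by (subst sum.inter_filter[OF finite_partitions]) (auto intro!: sum.cong)
  have "int (\<Sum>p\<in>O_le j r n. num_different_parts p)
    = (\<Sum>p\<in>?P. int (num_different_parts p) * f (card (multiple_parts r p)))"
    by (simp add: O_le_def restrict f_def multiple_parts_def)
  moreover have "int (\<Sum>p\<in>D_le j r n. num_different_parts p)
    = (\<Sum>p\<in>?P. int (num_different_parts p) * f (?d p))"
    by (simp add: D_le_def restrict f_def repeated_parts_def)
  moreover have "int (T (j + 1) r n)
    = - (\<Sum>p\<in>?P. int (card (middle_parts r p)) * (f (?d p) - f (?d p - 1)))"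
  proof -
    have "of_bool (m = j + 1) = - (f m - f (m - 1))" for m
      by (auto simp: f_def)
    then have "(\<Sum>p\<in>?P. int (card (middle_parts r p)) * of_bool (?d p = j + 1))
      = - (\<Sum>p\<in>?P. int (card (middle_parts r p)) * (f (?d p) - f (?d p - 1)))"
      by (simp only: mult_minus_right sum_negf)
    then show ?thesis
      by (simp add: T_def D_eq_def restrict middle_parts_def repeated_parts_def)
  qed
  ultimately show ?thesis
    using weighted_identity[where r = r and n = n and f = f] assms by (simp add: b'_le_def)
qed

end
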